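(* There are an integer $d\ge3$ and a closed, non-discrete, compactly generated, locally transitive subgroup of $\mathrm{Aut}(T_d)$ with open, hence non-discrete, quasi-center.
   Context: $T_d=(V,E)$ is the $d$-regular tree with its set $E$ of oriented edges; $E(x)$ is the set of edges with origin $x$. $\mathrm{Aut}(T_d)$ carries the permutation topology for its action on $V\cup E$ (basic open sets prescribe the images of finitely many points). A subgroup $H\le\mathrm{Aut}(T_d)$ is locally transitive if for every $x\in V$ the stabilizer $H_x$ acts transitively on $E(x)$. The quasi-center of a topological group $H$ is $\mathrm{QZ}(H):=\{h\in H\mid Z_H(h)\text{ is open in }H\}$. *)

theory Defs
  imports
    "HOL-Analysis.Analysis"
    "HOL-Algebra.Generated_Groups"
    "HOL-Algebra.Group_Action"
    "Graph_Theory.Digraph_Component"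
begin

section \<open>Regular trees\<close>

text \<open>
  A tree has no loops and no multiple edges, so its oriented edges are represented by the pairs
  (origin, terminus) of adjacent vertices, each geometric edge contributing both orientations.
  The library predicate \<^const>\<open>forest\<close> cannot be used, because for it the walk from \<open>u\<close> to a
  neighbour \<open>v\<close> and back is already a cycle; here only cycles of length at least 3 count.
  The \<open>d\<close>-regular tree is unique up to isomorphism and, being countable, has copies on the vertex
  type \<open>nat list\<close>.  Since \<open>card\<close> is 0 on infinite sets, a positive degree forces local finiteness.
\<close>

definition regular_tree :: "nat \<Rightarrow> 'v pair_pre_digraph \<Rightarrow> bool" where
  "regular_tree d T \<longleftrightarrow>
     pair_bidirected_digraph T \<and>
     Digraph_Component.connected (with_proj T) \<and>
     (\<nexists>p. pre_digraph.cycle (with_proj T) p \<and> 3 \<le> length p) \<and>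
     (\<forall>x \<in> pverts T. out_degree (with_proj T) x = d)"


section \<open>The automorphism group with the permutation topology\<close>

definition tree_aut :: "'v pair_pre_digraph \<Rightarrow> ('v \<Rightarrow> 'v) set" where
  "tree_aut T = {g \<in> Bij (pverts T).
     \<forall>x \<in> pverts T. \<forall>y \<in> pverts T. (g x, g y) \<in> parcs T \<longleftrightarrow> (x, y) \<in> parcs T}"

text \<open>
  Subgroups \<open>H\<close> of the automorphism group are treated as sets of automorphisms;
  \<open>aut_subgroup T H\<close> is the group structure carried by such a set.
\<close>

definition aut_subgroup :: "'v pair_pre_digraph \<Rightarrow> ('v \<Rightarrow> 'v) set \<Rightarrow> ('v \<Rightarrow> 'v) monoid" where
  "aut_subgroup T H = (BijGroup (pverts T))\<lparr>carrier := H\<rparr>"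

abbreviation aut_group :: "'v pair_pre_digraph \<Rightarrow> ('v \<Rightarrow> 'v) monoid" where
  "aut_group T \<equiv> aut_subgroup T (tree_aut T)"

text \<open>The action on the disjoint union \<open>pverts T <+> parcs T\<close> of vertices and oriented edges.\<close>

definition vert_edge_act :: "('v \<Rightarrow> 'v) \<Rightarrow> 'v + 'v \<times> 'v \<Rightarrow> 'v + 'v \<times> 'v" where
  "vert_edge_act g = map_sum g (map_prod g g)"

definition perm_topology :: "'v pair_pre_digraph \<Rightarrow> ('v \<Rightarrow> 'v) topology" where
  "perm_topology T = topology_generated_by
     {{g \<in> tree_aut T. \<forall>p \<in> F. vert_edge_act g p = \<phi> p} | F \<phi>.
        finite F \<and> F \<subseteq> pverts T <+> parcs T}"

definition locally_transitive :: "'v pair_pre_digraph \<Rightarrow> ('v \<Rightarrow> 'v) set \<Rightarrow> bool" where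
  "locally_transitive T H \<longleftrightarrow>
     (\<forall>x \<in> pverts T. \<forall>e \<in> out_arcs (with_proj T) x. \<forall>e' \<in> out_arcs (with_proj T) x.
        \<exists>h \<in> stabilizer (aut_subgroup T H) (\<lambda>g. g) x. map_prod h h e = e')"


section \<open>Topological groups\<close>

text \<open>A topological group is given by a group \<open>G\<close> and a topology \<open>\<tau>\<close> on its carrier.\<close>

definition compactly_generated :: "('g, 'm) monoid_scheme \<Rightarrow> 'g topology \<Rightarrow> bool" where
  "compactly_generated G \<tau> \<longleftrightarrow> (\<exists>K. compactin \<tau> K \<and> generate G K = carrier G)"

definition centralizer :: "('g, 'm) monoid_scheme \<Rightarrow> 'g \<Rightarrow> 'g set" where
  "centralizer G h = {g \<in> carrier G. g \<otimes>\<^bsub>G\<^esub> h = h \<otimes>\<^bsub>G\<^esub> g}"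

definition quasi_center :: "('g, 'm) monoid_scheme \<Rightarrow> 'g topology \<Rightarrow> 'g set" where
  "quasi_center G \<tau> = {h \<in> carrier G. openin \<tau> (centralizer G h)}"

definition discrete_in :: "'g topology \<Rightarrow> 'g set \<Rightarrow> bool" where
  "discrete_in \<tau> S \<longleftrightarrow> subtopology \<tau> S = discrete_topology S"

end

theory Submission
  imports Defs
begin

text \<open>
  The witness is a group \<open>H\<close> of automorphisms of the 4-regular tree. Map the tree onto the line
  \<open>\<int>\<close> so that every vertex at level \<open>n\<close> has two neighbours at level \<open>n + 1\<close> and two at level
  \<open>n - 1\<close>, and label the edges by the letters \<open>0, 1, 2, 3\<close> such that the two edges leading up from
  a vertex differ by 2, and likewise the two edges leading down; the tree is the Cayley tree of the
  free product of four groups of order 2. \<open>H\<close> consists of the automorphisms that permute the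
  levels and whose action on the labels around a vertex depends only on the level of the vertex.

  An element of \<open>H\<close> that fixes the root and does not turn the line around preserves every level.
  Its only freedom is to exchange, for each edge \<open>{m, m + 1}\<close> of the line, the two labels above that
  edge, simultaneously at all vertices. So these elements form a group \<open>A\<close> isomorphic to the product
  of \<open>\<int>\<close> many copies of \<open>\<int>/2\<close> (\<open>rigid_is_switch\<close>). It is infinite and compact, since it is a
  continuous image of the Cantor space of all subsets of \<open>\<int>\<close>
  (\<open>compactin_range_switch_aut\<close>), hence not discrete. It is abelian, and it is open in \<open>H\<close>, because
  membership is decided by the images of two vertices.

  In a group with an open abelian subgroup \<open>A\<close>, every element of \<open>A\<close> has an open centralizer. So the
  quasi-center is a subgroup containing \<open>A\<close>, and therefore open
  (\<open>open_abelian_subgroup_in_quasi_center\<close>). In particular neither \<open>H\<close> nor its quasi-center is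
  discrete.

  The left translations of the free product belong to \<open>H\<close> and make it vertex transitive. Relabelling
  by \<open>k \<mapsto> 3 - k\<close> reflects the line, and together with \<open>A\<close> it moves any edge at the root to any
  other, so \<open>H\<close> is locally transitive. The same elements generate \<open>H\<close>: the compact set \<open>A\<close>, four
  translations and the reflection (\<open>generate_generators\<close>). Finally \<open>H\<close> is closed, since its defining
  condition compares finitely many vertices at a time.
\<close>

section \<open>Groups with continuous left translations\<close>

text \<open>
  Left translations carry an open neighbourhood of one point of a subgroup to every other point.
\<close>

locale left_topological_group = group G for G (structure) +
  fixes \<tau> :: "'a topology"
  assumes topspace_carrier: "topspace \<tau> = carrier G"
    and left_translation_continuous: "g \<in> carrier G \<Longrightarrow> continuous_map \<tau> \<tau> (\<lambda>h. g \<otimes> h)"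
begin

text \<open>
  The left translates of a nonempty open subset \<open>W\<close> by elements of \<open>S\<close> cover \<open>S\<close> and stay inside it.
\<close>

lemma subgroup_openI:
  assumes S: "subgroup S G" and W: "openin \<tau> W" "W \<subseteq> S" "W \<noteq> {}"
  shows "openin \<tau> S"
proof (subst openin_subopen, intro ballI)
  fix s assume s: "s \<in> S"
  obtain w where w: "w \<in> W" using W(3) by auto
  have [simp]: "s \<in> carrier G" "w \<in> carrier G" using s w W(2) subgroup.subset[OF S] by auto
  \<comment> \<open>The translation by \<open>w \<otimes> inv s\<close> carries \<open>s\<close> to the point \<open>w\<close> of \<open>W\<close>.\<close>
  define N where "N = {h \<in> topspace \<tau>. (w \<otimes> inv s) \<otimes> h \<in> W}"
  have "openin \<tau> N"
    unfolding N_def by (rule openin_continuous_map_preimage[OF left_translation_continuous W(1)]) simp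
  moreover have "s \<in> N"
    using w by (simp add: N_def topspace_carrier m_assoc)
  moreover have "h \<in> S" if "h \<in> N" for h
  proof -
    have h: "h \<in> carrier G" "(w \<otimes> inv s) \<otimes> h \<in> S"
      using that W(2) by (auto simp: N_def topspace_carrier)
    define c where "c = w \<otimes> inv s"
    have "c \<in> S" unfolding c_def
      using s w W(2) by (intro subgroup.m_closed[OF S] subgroup.m_inv_closed[OF S]) auto
    then have "inv c \<otimes> (c \<otimes> h) \<in> S"
      using h(2) subgroup.m_closed[OF S subgroup.m_inv_closed[OF S]] by (simp add: c_def)
    moreover have "c \<in> carrier G" by (simp add: c_def)
    ultimately show "h \<in> S" using h(1) by (simp add: m_assoc[symmetric])
  qed
  ultimately show "\<exists>N. openin \<tau> N \<and> s \<in> N \<and> N \<subseteq> S" by blast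
qed

lemma subgroup_centralizer:
  assumes h: "h \<in> carrier G"
  shows "subgroup (centralizer G h) G"
proof (rule subgroupI)
  show "centralizer G h \<noteq> {}" using h by (auto simp: centralizer_def)
next
  fix a assume "a \<in> centralizer G h"
  then have a: "a \<in> carrier G" "a \<otimes> h = h \<otimes> a" by (auto simp: centralizer_def)
  have "a \<otimes> (h \<otimes> inv a) = h"
    using a h by (metis inv_closed m_assoc r_inv r_one)
  then have "inv a \<otimes> h = h \<otimes> inv a"
    using a(1) h by (metis inv_closed inv_solve_left m_closed)
  then show "inv a \<in> centralizer G h" using a(1) by (simp add: centralizer_def)
next
  fix a b assume "a \<in> centralizer G h" "b \<in> centralizer G h"
  then have *: "a \<in> carrier G" "a \<otimes> h = h \<otimes> a" "b \<in> carrier G" "b \<otimes> h = h \<otimes> b"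
    by (auto simp: centralizer_def)
  have "(a \<otimes> b) \<otimes> h = a \<otimes> (h \<otimes> b)" using * h by (simp add: m_assoc)
  also have "\<dots> = h \<otimes> (a \<otimes> b)" using * h by (metis m_assoc)
  finally show "a \<otimes> b \<in> centralizer G h" using * by (simp add: centralizer_def)
qed (auto simp: centralizer_def)

lemma centralizer_commute:
  "h \<in> carrier G \<Longrightarrow> g \<in> centralizer G h \<longleftrightarrow> g \<in> carrier G \<and> h \<in> centralizer G g"
  by (auto simp: centralizer_def)

text \<open>
  The centralizer of a product contains the intersection of the two centralizers. That intersection
  is open and contains \<open>\<one>\<close>, which makes the larger subgroup open.
\<close>

lemma subgroup_quasi_center: "subgroup (quasi_center G \<tau>) G"
proof (rule subgroupI)
  have "centralizer G \<one> = topspace \<tau>" by (auto simp: centralizer_def topspace_carrier)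
  then show "quasi_center G \<tau> \<noteq> {}" by (auto simp: quasi_center_def intro!: exI[of _ \<one>])
next
  fix a assume "a \<in> quasi_center G \<tau>"
  then have a: "a \<in> carrier G" "openin \<tau> (centralizer G a)" by (auto simp: quasi_center_def)
  have "inv x \<in> centralizer G g" if "x \<in> centralizer G g" "g \<in> carrier G" for x g
    using subgroup.m_inv_closed[OF subgroup_centralizer] that by blast
  then have "centralizer G (inv a) = centralizer G a"
    using a(1) by (metis (no_types, lifting) centralizer_commute inv_closed inv_inv subsetI subset_antisym)
  then show "inv a \<in> quasi_center G \<tau>" using a by (simp add: quasi_center_def)
next
  fix a b assume "a \<in> quasi_center G \<tau>" "b \<in> quasi_center G \<tau>"
  then have *: "a \<in> carrier G" "openin \<tau> (centralizer G a)" "b \<in> carrier G" "openin \<tau> (centralizer G b)"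
    by (auto simp: quasi_center_def)
  have "openin \<tau> (centralizer G (a \<otimes> b))"
  proof (rule subgroup_openI[OF subgroup_centralizer])
    show "openin \<tau> (centralizer G a \<inter> centralizer G b)" using * by auto
    show "centralizer G a \<inter> centralizer G b \<subseteq> centralizer G (a \<otimes> b)"
    proof
      fix x assume "x \<in> centralizer G a \<inter> centralizer G b"
      then have "x \<in> carrier G" "a \<in> centralizer G x" "b \<in> centralizer G x"
        using * by (auto simp: centralizer_def)
      then show "x \<in> centralizer G (a \<otimes> b)"
        using * subgroup.m_closed[OF subgroup_centralizer] centralizer_commute by blast
    qed
    show "centralizer G a \<inter> centralizer G b \<noteq> {}"
      using * by (auto simp: centralizer_def intro!: exI[of _ \<one>])
  qed (use * in auto)
  then show "a \<otimes> b \<in> quasi_center G \<tau>" using * by (simp add: quasi_center_def)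
qed (auto simp: quasi_center_def)

text \<open>
  The centralizer of an element of \<open>A\<close> is a subgroup that contains the open set \<open>A\<close>, so it is open.
  Then the quasi-center is itself a subgroup that contains \<open>A\<close>.
\<close>

lemma open_abelian_subgroup_in_quasi_center:
  assumes A: "openin \<tau> A" "A \<noteq> {}" and comm: "\<And>a b. a \<in> A \<Longrightarrow> b \<in> A \<Longrightarrow> a \<otimes> b = b \<otimes> a"
  shows "A \<subseteq> quasi_center G \<tau>" "openin \<tau> (quasi_center G \<tau>)"
proof -
  have AG: "A \<subseteq> carrier G" using openin_subset[OF A(1)] by (simp add: topspace_carrier)
  show sub: "A \<subseteq> quasi_center G \<tau>"
  proof
    fix a assume a: "a \<in> A"
    have "openin \<tau> (centralizer G a)"
      by (rule subgroup_openI[OF subgroup_centralizer A(1) _ A(2)])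
        (use a AG comm in \<open>auto simp: centralizer_def\<close>)
    then show "a \<in> quasi_center G \<tau>" using a AG by (auto simp: quasi_center_def)
  qed
  show "openin \<tau> (quasi_center G \<tau>)"
    by (rule subgroup_openI[OF subgroup_quasi_center A(1) sub A(2)])
qed

end

text \<open>
  This turns non-discreteness into the existence of an infinite compact subset.
\<close>

lemma discrete_in_compact_finite:
  assumes "discrete_in \<tau> S" "compactin \<tau> K" "K \<subseteq> S"
  shows "finite K"
  using assms compactin_discrete_topology compactin_subtopology unfolding discrete_in_def by metis

section \<open>The permutation topology\<close>

lemma topspace_perm_topology: "topspace (perm_topology T) = tree_aut T"
proof (rule antisym)
  have "openin (perm_topology T) {g \<in> tree_aut T. \<forall>p \<in> {}. vert_edge_act g p = p}"
    unfolding perm_topology_def by (rule topology_generated_by_Basis) blast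
  then show "tree_aut T \<subseteq> topspace (perm_topology T)" using openin_subset by simp
qed (auto simp: perm_topology_def)

text \<open>
  The union, over all \<open>g\<close> with \<open>Q g\<close>, of the basic sets prescribing the values of \<open>g\<close> on \<open>F\<close>.
\<close>

lemma openin_perm_topology_finite_dependence:
  assumes F: "finite F" "F \<subseteq> pverts T"
    and Q: "\<And>g h. (\<And>x. x \<in> F \<Longrightarrow> g x = h x) \<Longrightarrow> Q g \<Longrightarrow> Q h"
  shows "openin (perm_topology T) {g \<in> tree_aut T. Q g}"
proof (subst openin_subopen, intro ballI)
  fix g assume g: "g \<in> {g \<in> tree_aut T. Q g}"
  let ?U = "{h \<in> tree_aut T. \<forall>p \<in> Inl ` F. vert_edge_act h p = vert_edge_act g p}"
  have "openin (perm_topology T) ?U"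
    unfolding perm_topology_def
    by (rule topology_generated_by_Basis, rule CollectI, rule exI[of _ "Inl ` F"],
        rule exI[of _ "vert_edge_act g"]) (use F in auto)
  moreover have "?U \<subseteq> {g \<in> tree_aut T. Q g}"
    using g Q[of g] by (auto simp: vert_edge_act_def)
  ultimately show "\<exists>U. openin (perm_topology T) U \<and> g \<in> U \<and> U \<subseteq> {g \<in> tree_aut T. Q g}"
    using g by blast
qed

text \<open>
  The permutation topology is the topology of pointwise convergence on the vertices: the action on an
  edge is determined by the action on its two ends.
\<close>

lemma continuous_map_into_perm_topology:
  assumes wf: "pair_wf_digraph T"
    and f: "\<And>a. a \<in> topspace X \<Longrightarrow> f a \<in> tree_aut T"
    and pointwise: "\<And>x y. x \<in> pverts T \<Longrightarrow> openin X {a \<in> topspace X. f a x = y}"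
  shows "continuous_map X (perm_topology T) f"
  unfolding perm_topology_def continuous_on_generated_topo_iff
proof (intro conjI allI impI)
  show "f ` topspace X \<subseteq> \<Union> {{g \<in> tree_aut T. \<forall>p\<in>F. vert_edge_act g p = \<phi> p} |F \<phi>.
      finite F \<and> F \<subseteq> pverts T <+> parcs T}"
    using f topspace_perm_topology[of T]
    unfolding perm_topology_def topology_generated_by_topspace by auto
  fix U assume "U \<in> {{g \<in> tree_aut T. \<forall>p\<in>F. vert_edge_act g p = \<phi> p} |F \<phi>.
      finite F \<and> F \<subseteq> pverts T <+> parcs T}"
  then obtain F \<phi> where F: "finite F" "F \<subseteq> pverts T <+> parcs T"
    and U: "U = {g \<in> tree_aut T. \<forall>p\<in>F. vert_edge_act g p = \<phi> p}" by blast
  have "openin X {a \<in> topspace X. vert_edge_act (f a) p = \<phi> p}" if p: "p \<in> F" for p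
  proof (cases p)
    case (Inl x)
    have "{a \<in> topspace X. vert_edge_act (f a) p = \<phi> p} =
        (if isl (\<phi> p) then {a \<in> topspace X. f a x = projl (\<phi> p)} else {})"
      using Inl by (cases "\<phi> p") (auto simp: vert_edge_act_def)
    then show ?thesis using pointwise[of x] p F(2) Inl by auto
  next
    case (Inr e)
    then have e: "fst e \<in> pverts T" "snd e \<in> pverts T"
      using p F(2) wf pair_wf_digraph.arc_fst_in_verts pair_wf_digraph.arc_snd_in_verts by fast+
    have "{a \<in> topspace X. vert_edge_act (f a) p = \<phi> p} =
        (if isl (\<phi> p) then {} else {a \<in> topspace X. f a (fst e) = fst (projr (\<phi> p))} \<inter>
          {a \<in> topspace X. f a (snd e) = snd (projr (\<phi> p))})"
      using Inr by (cases "\<phi> p") (auto simp: vert_edge_act_def prod_eq_iff)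
    then show ?thesis using pointwise[OF e(1)] pointwise[OF e(2)] by auto
  qed
  then have "openin X ((\<Inter>p\<in>F. {a \<in> topspace X. vert_edge_act (f a) p = \<phi> p}) \<inter> topspace X)"
    using F(1) by (intro openin_INT) auto
  moreover have "(\<Inter>p\<in>F. {a \<in> topspace X. vert_edge_act (f a) p = \<phi> p}) \<inter> topspace X = f -` U \<inter> topspace X"
    using f by (auto simp: U)
  ultimately show "openin X (f -` U \<inter> topspace X)" by simp
qed

lemma tree_aut_closed: "g \<in> tree_aut T \<Longrightarrow> x \<in> pverts T \<Longrightarrow> g x \<in> pverts T"
  unfolding tree_aut_def using Bij_imp_funcset by blast

lemma compose_tree_aut: "g \<in> tree_aut T \<Longrightarrow> h \<in> tree_aut T \<Longrightarrow> compose (pverts T) g h \<in> tree_aut T"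
  using tree_aut_closed[of h T] by (auto simp: tree_aut_def compose_Bij compose_eq)

lemma subgroup_tree_aut: "subgroup (tree_aut T) (BijGroup (pverts T))"
proof (rule group.subgroupI[OF group_BijGroup])
  show "tree_aut T \<subseteq> carrier (BijGroup (pverts T))" by (auto simp: tree_aut_def BijGroup_def)
  show "tree_aut T \<noteq> {}" using id_Bij[of "pverts T"] by (force simp: tree_aut_def)
next
  fix g assume g: "g \<in> tree_aut T"
  then have gB: "g \<in> Bij (pverts T)" by (simp add: tree_aut_def)
  then have bij: "bij_betw g (pverts T) (pverts T)" by (simp add: Bij_def)
  have "(inv_into (pverts T) g x, inv_into (pverts T) g y) \<in> parcs T \<longleftrightarrow> (x, y) \<in> parcs T"
    if "x \<in> pverts T" "y \<in> pverts T" for x y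
  proof -
    have "x \<in> g ` pverts T" "y \<in> g ` pverts T" using bij that by (auto simp: bij_betw_def)
    then obtain x' y' where "x' \<in> pverts T" "y' \<in> pverts T" "x = g x'" "y = g y'" by blast
    then show ?thesis using g
      by (simp add: tree_aut_def bij_betw_inv_into_left[OF bij])
  qed
  then show "inv\<^bsub>BijGroup (pverts T)\<^esub> g \<in> tree_aut T"
    using gB by (simp add: tree_aut_def inv_BijGroup restrict_inv_into_Bij)
next
  fix g h assume "g \<in> tree_aut T" "h \<in> tree_aut T"
  moreover from this have "g \<in> Bij (pverts T)" "h \<in> Bij (pverts T)" by (simp_all add: tree_aut_def)
  ultimately show "g \<otimes>\<^bsub>BijGroup (pverts T)\<^esub> h \<in> tree_aut T"
    by (simp add: BijGroup_def compose_tree_aut)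
qed

text \<open>
  The value of \<open>g \<circ> h\<close> at \<open>x\<close> depends only on the value of \<open>h\<close> at \<open>x\<close>, so left translations are
  pointwise continuous.
\<close>

lemma left_topological_aut_subgroup:
  assumes wf: "pair_wf_digraph T" and H: "subgroup H (BijGroup (pverts T))" "H \<subseteq> tree_aut T"
  shows "left_topological_group (aut_subgroup T H) (subtopology (perm_topology T) H)"
proof (rule left_topological_group.intro)
  show G: "group (aut_subgroup T H)"
    unfolding aut_subgroup_def by (rule subgroup.subgroup_is_group[OF H(1) group_BijGroup])
  show "left_topological_group_axioms (aut_subgroup T H) (subtopology (perm_topology T) H)"
  proof
    show "topspace (subtopology (perm_topology T) H) = carrier (aut_subgroup T H)"
      using H(2) by (auto simp: topspace_perm_topology aut_subgroup_def)
    fix g assume "g \<in> carrier (aut_subgroup T H)"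
    then have g: "g \<in> H" by (simp add: aut_subgroup_def)
    have mult: "g \<otimes>\<^bsub>aut_subgroup T H\<^esub> h = compose (pverts T) g h" if "h \<in> H" for h
      using g that H(2) by (auto simp: aut_subgroup_def BijGroup_def tree_aut_def)
    have "continuous_map (perm_topology T) (perm_topology T) (compose (pverts T) g)"
    proof (rule continuous_map_into_perm_topology[OF wf])
      fix x y assume x: "x \<in> pverts T"
      have "openin (perm_topology T) {h \<in> tree_aut T. compose (pverts T) g h x = y}"
        by (rule openin_perm_topology_finite_dependence[of "{x}"]) (use x in \<open>auto simp: compose_eq\<close>)
      then show "openin (perm_topology T) {h \<in> topspace (perm_topology T). compose (pverts T) g h x = y}"
        by (simp add: topspace_perm_topology)
    qed (use g H(2) in \<open>auto simp: topspace_perm_topology intro: compose_tree_aut\<close>)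
    then have "continuous_map (subtopology (perm_topology T) H) (perm_topology T) (compose (pverts T) g)"
      by (rule continuous_map_from_subtopology)
    then have "continuous_map (subtopology (perm_topology T) H) (perm_topology T)
        (\<lambda>h. g \<otimes>\<^bsub>aut_subgroup T H\<^esub> h)"
      by (rule continuous_map_eq) (simp add: mult)
    then show "continuous_map (subtopology (perm_topology T) H) (subtopology (perm_topology T) H)
        (\<lambda>h. g \<otimes>\<^bsub>aut_subgroup T H\<^esub> h)"
      using g monoid.m_closed[OF group.is_monoid[OF G], of g]
      by (auto simp: continuous_map_in_subtopology aut_subgroup_def)
  qed
qed

section \<open>The regular tree of reduced words\<close>

text \<open>
  The reduced words in \<open>d\<close> generators of order 2. The head of the list is the letter furthest from
  the root \<open>[]\<close>.
\<close>

definition words :: "nat \<Rightarrow> nat list set" where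
  "words d = {w. set w \<subseteq> {..<d} \<and> distinct_adj w}"

text \<open>
  Right multiplication by the generator \<open>k\<close> in the free product, that is, crossing the edge labelled
  \<open>k\<close>.
\<close>

definition step :: "nat \<Rightarrow> nat list \<Rightarrow> nat list" where
  "step k w = (if w \<noteq> [] \<and> hd w = k then tl w else k # w)"

lemma step_Nil [simp]: "step k [] = [k]"
  and step_Cons [simp]: "step k (j # w) = (if j = k then w else k # j # w)"
  by (simp_all add: step_def)

lemma Nil_words [simp]: "[] \<in> words d"
  by (simp add: words_def)

lemma Cons_words: "k # w \<in> words d \<longleftrightarrow> k < d \<and> w \<in> words d \<and> (w = [] \<or> hd w \<noteq> k)"
  by (cases w) (auto simp: words_def)

lemma Cons_words_step: "k # w \<in> words d \<Longrightarrow> step k w = k # w"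
  by (auto simp: Cons_words step_def)

lemma step_words [simp]: "w \<in> words d \<Longrightarrow> k < d \<Longrightarrow> step k w \<in> words d"
  by (cases w) (auto simp: Cons_words)

lemma step_step [simp]: "w \<in> words d \<Longrightarrow> step k (step k w) = w"
  by (cases w) (auto simp: Cons_words step_def)

lemma length_step: "length (step k w) = Suc (length w) \<or> Suc (length (step k w)) = length w"
  by (cases w) auto

lemma step_inject [simp]: "step j w = step k w \<longleftrightarrow> j = k"
  by (cases w) (auto dest: arg_cong[of _ _ length])

lemma step_neq [simp]: "step k w \<noteq> w" "w \<noteq> step k w"
  using length_step[of k w] by auto

text \<open>
  Walking away from the root one edge at a time. With \<open>step\<close> in place of the list constructor, no
  case distinction on cancellation is needed in the applications.
\<close>

lemma words_induct [consumes 1, case_names Nil step]: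
  assumes "w \<in> words d" "P []" "\<And>k w. w \<in> words d \<Longrightarrow> k < d \<Longrightarrow> P w \<Longrightarrow> P (step k w)"
  shows "P w"
  using assms(1)
proof (induction w)
  case (Cons k w)
  then have "P (step k w)" using assms(3) by (simp add: Cons_words)
  then show ?case using Cons_words_step[OF Cons.prems] by simp
qed (use assms(2) in simp)

definition word_tree :: "nat \<Rightarrow> nat list pair_pre_digraph" where
  "word_tree d = \<lparr>pverts = words d, parcs = {(w, step k w) | w k. w \<in> words d \<and> k < d}\<rparr>"

lemma pverts_word_tree [simp]: "pverts (word_tree d) = words d"
  by (simp add: word_tree_def)

lemma arc_word_tree_iff:
  "(x, y) \<in> parcs (word_tree d) \<longleftrightarrow> x \<in> words d \<and> (\<exists>k<d. y = step k x)"
  by (auto simp: word_tree_def)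

lemma arc_word_tree_sym: "(x, y) \<in> parcs (word_tree d) \<Longrightarrow> (y, x) \<in> parcs (word_tree d)"
  unfolding arc_word_tree_iff by (metis step_step step_words)

lemma pair_bidirected_word_tree: "pair_bidirected_digraph (word_tree d)"
  by unfold_locales
    (auto simp: arc_word_tree_iff symmetric_def intro!: symI dest: arc_word_tree_sym)

lemma pair_wf_word_tree: "pair_wf_digraph (word_tree d)"
  using pair_bidirected_word_tree
  by (simp add: pair_bidirected_digraph_def pair_sym_digraph_def)

lemma out_arcs_word_tree:
  "w \<in> words d \<Longrightarrow> out_arcs (with_proj (word_tree d)) w = (\<lambda>k. (w, step k w)) ` {..<d}"
  by (auto simp: arc_word_tree_iff)

lemma out_degree_word_tree: "w \<in> words d \<Longrightarrow> out_degree (with_proj (word_tree d)) w = d"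
  by (simp add: out_degree_def out_arcs_word_tree card_image inj_on_def)

lemma connected_word_tree: "Digraph_Component.connected (with_proj (word_tree d))"
  unfolding connected_conv
proof (intro conjI ballI)
  let ?r = "(parcs (word_tree d))\<^sup>s"
  have arc: "(w, step k w) \<in> ?r" "(step k w, w) \<in> ?r" if "w \<in> words d" "k < d" for k w
  proof -
    have "(w, step k w) \<in> parcs (word_tree d)" using that by (auto simp: arc_word_tree_iff)
    from this arc_word_tree_sym[OF this] show "(w, step k w) \<in> ?r" "(step k w, w) \<in> ?r"
      by (simp_all add: symcl_def)
  qed
  have from_root: "([], w) \<in> rtrancl_on (words d) ?r" if "w \<in> words d" for w
    using that
  proof (induction rule: words_induct)
    case (step k w)
    show ?case by (rule rtrancl_on_into_rtrancl_on[OF step.IH arc(1)]) (use step in simp_all)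
  qed simp
  have to_root: "(w, []) \<in> rtrancl_on (words d) ?r" if "w \<in> words d" for w
    using that
  proof (induction rule: words_induct)
    case (step k w)
    show ?case by (rule converse_rtrancl_on_into_rtrancl_on[OF arc(2) step.IH]) (use step in simp_all)
  qed simp
  fix u v
  assume "u \<in> verts (with_proj (word_tree d))" "v \<in> verts (with_proj (word_tree d))"
  then have "(u, v) \<in> rtrancl_on (words d) ?r"
    by (intro rtrancl_on_trans[OF to_root from_root]) simp_all
  then show "(u, v) \<in> rtrancl_on (verts (with_proj (word_tree d))) ((arcs_ends (with_proj (word_tree d)))\<^sup>s)"
    by simp
next
  show "verts (with_proj (word_tree d)) \<noteq> {}" using Nil_words[of d] by (simp, blast)
qed

lemma parent_word_tree:
  assumes "(x, y) \<in> parcs (word_tree d)" "length y \<le> length x"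
  shows "y = tl x"
  using assms by (auto simp: arc_word_tree_iff step_def split: if_splits)

text \<open>
  At a vertex of maximal length on a cycle, both neighbours on the cycle must be its parent. A cycle
  of length at least 3 visits these two neighbours as different vertices.
\<close>

lemma no_cycle_word_tree:
  assumes cyc: "pre_digraph.cycle (with_proj (word_tree d)) p" and len: "3 \<le> length p"
  shows False
proof -
  let ?n = "length p"
  interpret pair_wf_digraph "word_tree d" by (rule pair_wf_word_tree)
  obtain u where u: "pre_digraph.awalk (with_proj (word_tree d)) u p u"
    and dist: "distinct (tl (pawalk_verts u p))"
    using cyc unfolding pre_digraph.cycle_def by auto
  \<comment> \<open>The vertices of the cycle, numbered periodically by all natural numbers.\<close>
  define v where "v i = snd (p ! (i mod ?n))" for i
  have n0: "0 < ?n" using len by linarith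
  have arcs: "set p \<subseteq> parcs (word_tree d)" and cas: "pcas u p u"
    using u by (auto simp: pre_digraph.awalk_def)
  have snds: "tl (pawalk_verts u p) = map snd p"
  proof -
    have "pcas x q y \<Longrightarrow> pawalk_verts x q = x # map snd q" for x q y
      by (induction q arbitrary: x) auto
    from this[OF cas] show ?thesis by simp
  qed
  have consec: "fst (p ! Suc i) = snd (p ! i)" if "Suc i < ?n" for i
  proof -
    have "pcas x q y \<Longrightarrow> Suc i < length q \<Longrightarrow> fst (q ! Suc i) = snd (q ! i)" for x q y
    proof (induction q arbitrary: x i)
      case (Cons e es)
      then show ?case by (cases i; cases es) auto
    qed simp
    from this[OF cas that] show ?thesis .
  qed
  have closing: "fst (p ! 0) = snd (p ! (?n - 1))"
  proof -
    have "pcas x q y \<Longrightarrow> q \<noteq> [] \<Longrightarrow> fst (hd q) = x \<and> snd (last q) = y" for x q y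
      by (induction q arbitrary: x) auto
    from this[OF cas] show ?thesis using n0 by (auto simp: hd_conv_nth last_conv_nth)
  qed
  have adj: "(v i, v (Suc i)) \<in> parcs (word_tree d)" for i
  proof -
    have "v i = fst (p ! (Suc i mod ?n))"
    proof (cases "Suc (i mod ?n) = ?n")
      case True
      then have "i mod ?n = ?n - 1" by linarith
      then show ?thesis using True closing by (simp add: v_def mod_Suc)
    next
      case False
      moreover have "i mod ?n < ?n" using n0 by (rule mod_less_divisor)
      ultimately have "Suc (i mod ?n) < ?n" by linarith
      then show ?thesis using False consec by (simp add: v_def mod_Suc)
    qed
    moreover have "p ! (Suc i mod ?n) \<in> parcs (word_tree d)"
      using arcs n0 by (meson mod_less_divisor nth_mem subsetD)
    ultimately show ?thesis by (simp add: v_def)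
  qed
  have inj: "v i = v j \<Longrightarrow> i mod ?n = j mod ?n" for i j
    using dist n0 unfolding snds v_def
    by (metis length_map mod_less_divisor nth_eq_iff_index_eq nth_map)
  obtain i where i: "\<And>j. length (v j) \<le> length (v i)"
  proof -
    have "range (\<lambda>j. length (v j)) \<subseteq> (\<lambda>j. length (v j)) ` {..<?n}"
      using n0 by (auto simp: v_def intro!: image_eqI[of _ _ "_ mod ?n"])
    then have fin: "finite (range (\<lambda>j. length (v j)))" by (rule finite_subset) simp
    then have "Max (range (\<lambda>j. length (v j))) \<in> range (\<lambda>j. length (v j))" by (intro Max_in) auto
    then obtain i where "Max (range (\<lambda>j. length (v j))) = length (v i)" by auto
    then show thesis using that[of i] Max_ge[OF fin] by (metis rangeI)
  qed
  \<comment> \<open>The index \<open>j\<close> is that of the predecessor of \<open>v i\<close>; adding \<open>n - 1\<close> avoids the case \<open>i = 0\<close>.\<close>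
  define j where "j = i + (?n - 1)"
  have "Suc j = i + ?n" using n0 unfolding j_def by linarith
  then have vi: "v (Suc j) = v i" by (simp add: v_def)
  have "v (Suc i) = tl (v i)" using parent_word_tree[OF adj i] .
  moreover have "v j = tl (v i)"
    using parent_word_tree[OF arc_word_tree_sym[OF adj[of j, unfolded vi]] i] .
  ultimately have "Suc i mod ?n = j mod ?n" using inj by metis
  moreover have "Suc i \<le> j" "j - Suc i = ?n - 2" using len unfolding j_def by linarith+
  ultimately have "?n dvd ?n - 2" using mod_eq_dvd_iff_nat[of "Suc i" j ?n] by metis
  then have "?n \<le> ?n - 2" using len by (intro dvd_imp_le) linarith+
  then show False using len by linarith
qed

lemma regular_tree_word_tree: "regular_tree d (word_tree d)"
  unfolding regular_tree_def
  using pair_bidirected_word_tree connected_word_tree no_cycle_word_tree out_degree_word_tree by auto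

section \<open>Edge labels and local actions\<close>

definition edge_label :: "nat list \<Rightarrow> nat list \<Rightarrow> nat" where
  "edge_label x y = (if length x < length y then hd y else hd x)"

lemma edge_label_step [simp]: "edge_label w (step k w) = k" "edge_label (step k w) w = k"
  by (cases w; simp add: edge_label_def)+

text \<open>
  The permutation of the edge labels that \<open>g\<close> induces at the vertex \<open>w\<close>.
\<close>

definition local_action :: "(nat list \<Rightarrow> nat list) \<Rightarrow> nat list \<Rightarrow> nat \<Rightarrow> nat" where
  "local_action g w k = edge_label (g w) (g (step k w))"

lemma local_action_eqI: "g (step k w) = step j (g w) \<Longrightarrow> local_action g w k = j"
  by (simp add: local_action_def)

lemma tree_aut_step:
  assumes "g \<in> tree_aut (word_tree d)" "w \<in> words d" "k < d"
  shows "g (step k w) = step (local_action g w k) (g w)" "local_action g w k < d"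
proof -
  have "(w, step k w) \<in> parcs (word_tree d)" using assms by (auto simp: arc_word_tree_iff)
  then have "(g w, g (step k w)) \<in> parcs (word_tree d)"
    using assms by (auto simp: tree_aut_def)
  then obtain j where "j < d" "g (step k w) = step j (g w)" by (auto simp: arc_word_tree_iff)
  then show "g (step k w) = step (local_action g w k) (g w)" "local_action g w k < d"
    by (simp_all add: local_action_eqI)
qed

lemma words_closed: "g \<in> tree_aut (word_tree d) \<Longrightarrow> w \<in> words d \<Longrightarrow> g w \<in> words d"
  using tree_aut_closed[of g "word_tree d"] by simp

lemma tree_aut_inject:
  "g \<in> tree_aut (word_tree d) \<Longrightarrow> x \<in> words d \<Longrightarrow> y \<in> words d \<Longrightarrow> g x = g y \<longleftrightarrow> x = y"
  by (auto simp: tree_aut_def Bij_def bij_betw_def inj_on_def)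

text \<open>
  Both ends of an edge see the same label, before and after applying \<open>g\<close>.
\<close>

lemma local_action_back:
  assumes "g \<in> tree_aut (word_tree d)" "w \<in> words d" "k < d"
  shows "local_action g (step k w) k = local_action g w k"
  using assms tree_aut_step[OF assms] words_closed[OF assms(1,2)] by (intro local_action_eqI) simp

section \<open>Levels\<close>

text \<open>
  The level reached from level \<open>n\<close> along an edge labelled \<open>k\<close>. Letters and levels of equal parity go
  up and the others go down, so that crossing the same edge again leads back.
\<close>

definition next_level :: "nat \<Rightarrow> int \<Rightarrow> int" where
  "next_level k n = n + (if even (n + int k) then 1 else - 1)"

lemma next_level_back [simp]: "next_level k (next_level k n) = n"
  by (auto simp: next_level_def)

fun level :: "nat list \<Rightarrow> int" where
  "level [] = 0"
| "level (k # w) = next_level k (level w)"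

lemma level_step: "level (step k w) = next_level k (level w)"
  by (cases w) auto

lemma ex_upward_letter: obtains k where "k < 2" "next_level k n = n + 1"
proof
  show "(if even n then 0 else 1) < (2::nat)" "next_level (if even n then 0 else 1) n = n + 1"
    by (auto simp: next_level_def)
qed

lemma ex_downward_letter: obtains k where "k < 2" "next_level k n = n - 1"
proof
  show "(if even n then 1 else 0) < (2::nat)" "next_level (if even n then 1 else 0) n = n - 1"
    by (auto simp: next_level_def)
qed

lemma ex_word_level: "\<exists>w \<in> words 4. level w = n"
proof (induction n rule: int_induct[where k = 0])
  case base
  show ?case by (intro bexI[of _ "[]"]) simp_all
next
  case (step1 n)
  then obtain w where w: "w \<in> words 4" "level w = n" by blast
  obtain k where "k < 2" "next_level k n = n + 1" by (rule ex_upward_letter)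
  then show ?case using w by (intro bexI[of _ "step k w"]) (auto simp: level_step)
next
  case (step2 n)
  then obtain w where w: "w \<in> words 4" "level w = n" by blast
  obtain k where "k < 2" "next_level k n = n - 1" by (rule ex_downward_letter)
  then show ?case using w by (intro bexI[of _ "step k w"]) (auto simp: level_step)
qed

section \<open>The level group\<close>

text \<open>
  The conditions involve only \<open>x\<close>, \<open>y\<close> and their neighbours, which makes the resulting group closed.
\<close>

definition level_compatible :: "(nat list \<Rightarrow> nat list) \<Rightarrow> nat list \<Rightarrow> nat list \<Rightarrow> bool" where
  "level_compatible g x y \<longleftrightarrow> (level (g x) = level (g y) \<longleftrightarrow> level x = level y) \<and>
     (level x = level y \<longrightarrow> (\<forall>k<4. local_action g x k = local_action g y k))"

definition level_group :: "(nat list \<Rightarrow> nat list) set" where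
  "level_group = {g \<in> tree_aut (word_tree 4). \<forall>x \<in> words 4. \<forall>y \<in> words 4. level_compatible g x y}"

lemma level_group_aut: "g \<in> level_group \<Longrightarrow> g \<in> tree_aut (word_tree 4)"
  by (simp add: level_group_def)

lemma level_group_Bij: "g \<in> level_group \<Longrightarrow> g \<in> Bij (words 4)"
  by (simp add: level_group_def tree_aut_def)

lemmas level_group_words = words_closed[OF level_group_aut]

lemma level_group_level_iff:
  "g \<in> level_group \<Longrightarrow> x \<in> words 4 \<Longrightarrow> y \<in> words 4 \<Longrightarrow>
    level (g x) = level (g y) \<longleftrightarrow> level x = level y"
  by (simp add: level_group_def level_compatible_def)

lemma level_group_local_action:
  "g \<in> level_group \<Longrightarrow> x \<in> words 4 \<Longrightarrow> y \<in> words 4 \<Longrightarrow> level x = level y \<Longrightarrow> k < 4 \<Longrightarrow>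
    local_action g x k = local_action g y k"
  unfolding level_group_def level_compatible_def by blast

text \<open>
  For an involution, preservation in one direction gives bijectivity and both equivalences in the
  definition of the group at once. All explicit elements needed below are involutions.
\<close>

lemma involution_in_level_group:
  assumes F: "\<And>w. w \<in> words 4 \<Longrightarrow> F w \<in> words 4" "\<And>w. w \<in> words 4 \<Longrightarrow> F (F w) = w"
    and step: "\<And>w k. w \<in> words 4 \<Longrightarrow> k < 4 \<Longrightarrow> F (step k w) = step (\<kappa> (level w) k) (F w)"
    and \<kappa>: "\<And>n k. k < 4 \<Longrightarrow> \<kappa> n k < 4"
    and level: "\<And>w. w \<in> words 4 \<Longrightarrow> level (F w) = f (level w)"
  shows "restrict F (words 4) \<in> level_group"
proof -
  let ?g = "restrict F (words 4)"
  have "bij_betw F (words 4) (words 4)"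
    by (rule bij_betw_byWitness[where f' = F]) (use F in auto)
  then have "?g \<in> Bij (words 4)" by (simp add: Bij_def)
  moreover have arc: "(F x, F y) \<in> parcs (word_tree 4)"
    if "(x, y) \<in> parcs (word_tree 4)" for x y
    using that F(1) step \<kappa> by (auto simp: arc_word_tree_iff)
  have "(F x, F y) \<in> parcs (word_tree 4) \<longleftrightarrow> (x, y) \<in> parcs (word_tree 4)"
    if "x \<in> words 4" "y \<in> words 4" for x y
    using arc[of x y] arc[of "F x" "F y"] F(2) that by auto
  ultimately have aut: "?g \<in> tree_aut (word_tree 4)" by (simp add: tree_aut_def)
  have loc: "local_action ?g w k = \<kappa> (level w) k" if "w \<in> words 4" "k < 4" for w k
    using that step by (intro local_action_eqI) simp
  have "level (F x) = level (F y) \<longleftrightarrow> level x = level y" if "x \<in> words 4" "y \<in> words 4" for x y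
    using that F level by metis
  then show ?thesis using aut loc by (simp add: level_group_def level_compatible_def)
qed

text \<open>
  Local actions obey a chain rule, and its two factors depend only on levels.
\<close>

lemma compose_level_group:
  assumes g: "g \<in> level_group" and h: "h \<in> level_group"
  shows "compose (words 4) g h \<in> level_group"
proof -
  let ?gh = "compose (words 4) g h"
  have "?gh \<in> tree_aut (word_tree 4)"
    using compose_tree_aut[OF level_group_aut[OF g] level_group_aut[OF h]] by simp
  moreover have loc: "local_action ?gh x k = local_action g (h x) (local_action h x k)"
    if "x \<in> words 4" "k < 4" for x k
    using that tree_aut_step[OF level_group_aut[OF h]] tree_aut_step[OF level_group_aut[OF g]]
      level_group_words[OF h]
    by (intro local_action_eqI) (simp add: compose_eq)
  moreover have "level_compatible ?gh x y" if x: "x \<in> words 4" and y: "y \<in> words 4" for x y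
    unfolding level_compatible_def
  proof (intro conjI impI allI)
    show "level (?gh x) = level (?gh y) \<longleftrightarrow> level x = level y"
      using x y level_group_words[OF h]
      by (simp add: compose_eq level_group_level_iff[OF g] level_group_level_iff[OF h])
    fix k :: nat assume lev: "level x = level y" and k: "k < 4"
    have "level (h x) = level (h y)" using lev level_group_level_iff[OF h x y] by simp
    then have "local_action g (h x) (local_action h x k) = local_action g (h y) (local_action h x k)"
      by (rule level_group_local_action[OF g level_group_words[OF h x] level_group_words[OF h y]])
        (rule tree_aut_step(2)[OF level_group_aut[OF h] x k])
    then show "local_action ?gh x k = local_action ?gh y k"
      using loc[OF x k] loc[OF y k] level_group_local_action[OF h x y lev k] by simp
  qed
  ultimately show ?thesis by (simp add: level_group_def)
qed

text \<open>
  For inverses, the local action of the inverse at \<open>g x\<close> is the inverse of the local action of \<open>g\<close> at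
  \<open>x\<close>, and \<open>g x\<close> determines the level of \<open>x\<close> through its own level.
\<close>

lemma subgroup_level_group: "subgroup level_group (BijGroup (words 4))"
proof (rule group.subgroupI[OF group_BijGroup])
  show "level_group \<subseteq> carrier (BijGroup (words 4))"
    by (auto simp: BijGroup_def level_group_Bij)
  have "restrict (\<lambda>w. w) (words 4) \<in> level_group"
    by (rule involution_in_level_group[where \<kappa> = "\<lambda>n k. k" and f = "\<lambda>n. n"]) simp_all
  then show "level_group \<noteq> {}" by blast
next
  fix g assume g: "g \<in> level_group"
  have gB: "g \<in> Bij (words 4)" by (rule level_group_Bij[OF g])
  then have bij: "bij_betw g (words 4) (words 4)" by (simp add: Bij_def)
  define g' where "g' = inv\<^bsub>BijGroup (words 4)\<^esub> g"
  have aut: "g' \<in> tree_aut (word_tree 4)"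
    using subgroup.m_inv_closed[OF subgroup_tree_aut, of g "word_tree 4"] level_group_aut[OF g]
    by (simp add: g'_def)
  have inv: "g' (g x) = x" if "x \<in> words 4" for x
    using that gB level_group_words[OF g that] bij_betw_inv_into_left[OF bij]
    by (simp add: g'_def inv_BijGroup)
  have "level_compatible g' (g x) (g y)" if x: "x \<in> words 4" and y: "y \<in> words 4" for x y
    unfolding level_compatible_def
  proof (intro conjI impI allI)
    show "level (g' (g x)) = level (g' (g y)) \<longleftrightarrow> level (g x) = level (g y)"
      using level_group_level_iff[OF g x y] inv x y by simp
    assume "level (g x) = level (g y)"
    then have lev: "level x = level y" using level_group_level_iff[OF g x y] by simp
    fix k :: nat assume k: "k < 4"
    define j where "j = local_action g' (g x) k"
    have j: "j < 4" "g' (step k (g x)) = step j x"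
      using tree_aut_step[OF aut level_group_words[OF g x] k] inv[OF x] by (simp_all add: j_def)
    have "step k (g x) \<in> g ` words 4"
      using level_group_words[OF g x] k bij by (simp add: bij_betw_def)
    then obtain z where z: "z \<in> words 4" "step k (g x) = g z" by blast
    then have "z = step j x" using j(2) inv by simp
    then have "local_action g x j = k" using z(2) by (intro local_action_eqI) simp
    then have "local_action g y j = k" using level_group_local_action[OF g x y lev j(1)] by simp
    then have "g (step j y) = step k (g y)"
      using tree_aut_step(1)[OF level_group_aut[OF g] y j(1)] by simp
    then have "g' (step k (g y)) = step j (g' (g y))"
      using inv[of "step j y"] inv[OF y] y j(1) by simp
    then have "local_action g' (g y) k = j" by (rule local_action_eqI)
    then show "local_action g' (g x) k = local_action g' (g y) k" by (simp add: j_def)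
  qed
  moreover have "\<exists>z \<in> words 4. x = g z" if "x \<in> words 4" for x
    using bij that by (auto simp: bij_betw_def)
  ultimately have "level_compatible g' x y" if "x \<in> words 4" "y \<in> words 4" for x y
    using that by metis
  then show "inv\<^bsub>BijGroup (words 4)\<^esub> g \<in> level_group"
    using aut by (simp add: level_group_def g'_def)
next
  fix g h assume "g \<in> level_group" "h \<in> level_group"
  then show "g \<otimes>\<^bsub>BijGroup (words 4)\<^esub> h \<in> level_group"
    by (simp add: BijGroup_def compose_level_group level_group_Bij)
qed

section \<open>Relabellings and translations\<close>

fun relabel :: "(int \<Rightarrow> nat \<Rightarrow> nat) \<Rightarrow> nat list \<Rightarrow> nat list" where
  "relabel \<kappa> [] = []"
| "relabel \<kappa> (k # w) = \<kappa> (level w) k # relabel \<kappa> w"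

text \<open>
  The relabelling rule \<open>\<kappa> n\<close> is applied to the edges at vertices of level \<open>n\<close>, and \<open>f\<close> is the induced map
  of the line. The condition \<open>edge\<close> says that both ends of an edge agree on its new label, and \<open>invol\<close>
  that relabelling twice is the identity.
\<close>

locale level_relabelling =
  fixes \<kappa> :: "int \<Rightarrow> nat \<Rightarrow> nat" and f :: "int \<Rightarrow> int"
  assumes letter: "k < 4 \<Longrightarrow> \<kappa> n k < 4"
    and invol: "k < 4 \<Longrightarrow> \<kappa> (f n) (\<kappa> n k) = k"
    and edge: "k < 4 \<Longrightarrow> \<kappa> (next_level k n) k = \<kappa> n k"
    and root: "f 0 = 0"
    and next_level: "k < 4 \<Longrightarrow> f (next_level k n) = next_level (\<kappa> n k) (f n)"
begin

lemma relabel_step: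
  assumes "w \<in> words 4" "k < 4"
  shows "relabel \<kappa> (step k w) = step (\<kappa> (level w) k) (relabel \<kappa> w)"
proof (cases w)
  case (Cons j u)
  then have j: "j < 4" using assms by (simp add: Cons_words)
  show ?thesis
  proof (cases "j = k")
    case True
    then show ?thesis using Cons edge[OF j] by simp
  next
    case False
    have "\<kappa> (level u) j = \<kappa> (level w) j" using Cons edge[OF j] by simp
    then have "\<kappa> (level u) j \<noteq> \<kappa> (level w) k"
      using False invol[OF j] invol[OF assms(2)] by metis
    then show ?thesis using Cons False by simp
  qed
qed simp

lemma relabel_words: "w \<in> words 4 \<Longrightarrow> relabel \<kappa> w \<in> words 4"
  by (induction rule: words_induct) (simp_all add: relabel_step letter)

lemma level_relabel: "w \<in> words 4 \<Longrightarrow> level (relabel \<kappa> w) = f (level w)"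
  by (induction rule: words_induct) (simp_all add: relabel_step level_step root next_level)

lemma relabel_relabel: "w \<in> words 4 \<Longrightarrow> relabel \<kappa> (relabel \<kappa> w) = w"
  by (induction rule: words_induct)
    (simp_all add: relabel_step relabel_words level_relabel letter invol)

lemma relabel_in_level_group: "restrict (relabel \<kappa>) (words 4) \<in> level_group"
  by (rule involution_in_level_group[where \<kappa> = \<kappa> and f = f])
    (simp_all add: relabel_words relabel_relabel relabel_step letter level_relabel)

end

text \<open>
  \<open>\<theta>\<close> selects edges of the line, each named by its lower end; the labels above the selected edges are
  exchanged with their partners of equal parity.
\<close>

definition switch :: "(int \<Rightarrow> bool) \<Rightarrow> int \<Rightarrow> nat \<Rightarrow> nat" where
  "switch \<theta> n k = (if \<theta> (min n (next_level k n)) then (k + 2) mod 4 else k)"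

lemma next_level_switch: "next_level (switch \<theta> n k) m = next_level k m"
proof -
  have "even ((k + 2) mod 4) \<longleftrightarrow> even k" by presburger
  then have "even (m + int ((k + 2) mod 4)) \<longleftrightarrow> even (m + int k)"
    by (simp only: even_add even_of_nat)
  then have flip: "next_level ((k + 2) mod 4) m = next_level k m"
    unfolding next_level_def by (simp only:)
  show ?thesis
    unfolding switch_def by (cases "\<theta> (min n (next_level k n))") (simp_all only: if_True if_False flip)
qed

lemma switch_letter: "k < 4 \<Longrightarrow> switch \<theta> n k < 4"
  by (simp add: switch_def)

lemma switch_switch:
  assumes "k < 4" shows "switch \<theta> n (switch \<theta>' n k) = switch (\<lambda>m. \<theta> m \<noteq> \<theta>' m) n k"
proof -
  have "((k + 2) mod 4 + 2) mod 4 = k" using assms by presburger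
  then show ?thesis using next_level_switch[of \<theta>' n k n] by (auto simp: switch_def)
qed

interpretation switch: level_relabelling "switch \<theta>" "\<lambda>n. n" for \<theta>
proof
  fix k :: nat and n :: int assume k: "k < 4"
  show "switch \<theta> n (switch \<theta> n k) = k" using k by (subst switch_switch) (simp_all add: switch_def)
  show "switch \<theta> (next_level k n) k = switch \<theta> n k" by (simp add: switch_def min.commute)
qed (simp_all add: next_level_switch switch_letter)

text \<open>
  Complementing the letters reverses their parity, which exchanges up and down.
\<close>

interpretation reflection: level_relabelling "\<lambda>n k. 3 - k" "\<lambda>n. - n"
proof
  fix k :: nat and n :: int assume k: "k < 4"
  then have "int (3 - k) = 3 - int k" by simp
  then show "- next_level k n = next_level (3 - k) (- n)"
    by (auto simp: next_level_def)
qed auto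

text \<open>
  Left multiplication by the generator \<open>j\<close> in the free product.
\<close>

fun shift :: "nat \<Rightarrow> nat list \<Rightarrow> nat list" where
  "shift j [] = [j]"
| "shift j (k # w) = step k (shift j w)"

lemma shift_words: "w \<in> words 4 \<Longrightarrow> j < 4 \<Longrightarrow> shift j w \<in> words 4"
  by (induction w) (auto simp: Cons_words)

lemma shift_step:
  assumes "w \<in> words 4" "j < 4" shows "shift j (step k w) = step k (shift j w)"
  using assms shift_words[of _ j] by (cases w) (auto simp: Cons_words step_step[of _ 4])

lemma shift_shift: "w \<in> words 4 \<Longrightarrow> j < 4 \<Longrightarrow> shift j (shift j w) = w"
  by (induction rule: words_induct) (simp_all add: shift_step shift_words)

lemma level_shift: "w \<in> words 4 \<Longrightarrow> j < 4 \<Longrightarrow> level (shift j w) = next_level j 0 - level w"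
  by (induction rule: words_induct) (auto simp: shift_step level_step next_level_def)

lemma shift_in_level_group: "j < 4 \<Longrightarrow> restrict (shift j) (words 4) \<in> level_group"
  by (rule involution_in_level_group[where \<kappa> = "\<lambda>n k. k" and f = "\<lambda>n. next_level j 0 - n"])
    (simp_all add: shift_words shift_shift shift_step level_shift)

section \<open>The open abelian subgroup\<close>

definition switch_aut :: "(int \<Rightarrow> bool) \<Rightarrow> nat list \<Rightarrow> nat list" where
  "switch_aut \<theta> = restrict (relabel (switch \<theta>)) (words 4)"

lemma switch_aut_in_level_group: "switch_aut \<theta> \<in> level_group"
  unfolding switch_aut_def by (rule switch.relabel_in_level_group)

lemma switch_aut_compose:
  "compose (words 4) (switch_aut \<theta>) (switch_aut \<theta>') = switch_aut (\<lambda>m. \<theta> m \<noteq> \<theta>' m)"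
proof -
  have "relabel (switch \<theta>) (relabel (switch \<theta>') w) = relabel (switch (\<lambda>m. \<theta> m \<noteq> \<theta>' m)) w"
    if "w \<in> words 4" for w
    using that
    by (induction rule: words_induct)
      (simp_all add: switch.relabel_step switch.relabel_words switch.level_relabel
        switch_letter switch_switch)
  then show ?thesis
    by (auto simp: compose_def switch_aut_def switch.relabel_words restrict_def)
qed

lemma switch_aut_commute:
  "compose (words 4) (switch_aut \<theta>) (switch_aut \<theta>') = compose (words 4) (switch_aut \<theta>') (switch_aut \<theta>)"
  by (simp add: switch_aut_compose eq_commute)

lemma singleton_words: "[k] \<in> words 4 \<longleftrightarrow> k < 4"
  by (simp add: Cons_words)

text \<open>
  The map \<open>f\<close> induced on levels is an injective self-map of the line that moves neighbours to
  neighbours. Knowing that it fixes 0 and 1 forces it to be the identity.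
\<close>

lemma level_preserving:
  assumes g: "g \<in> level_group" and root: "g [] = []" and "level (g [0]) = 1" and w: "w \<in> words 4"
  shows "level (g w) = level w"
proof -
  define W where "W n = (SOME w. w \<in> words 4 \<and> level w = n)" for n
  have W: "W n \<in> words 4" "level (W n) = n" for n
    using someI_ex[of "\<lambda>w. w \<in> words 4 \<and> level w = n"] ex_word_level[of n]
    by (auto simp: W_def)
  define f where "f n = level (g (W n))" for n
  have f: "level (g w) = f (level w)" if "w \<in> words 4" for w
    unfolding f_def using level_group_level_iff[OF g that W(1)] W(2) by simp
  have inj: "f m = f n \<Longrightarrow> m = n" for m n
    using level_group_level_iff[OF g W(1) W(1), of m n] W(2) by (simp add: f_def)
  have near: "f (n + 1) = f n + 1 \<or> f (n + 1) = f n - 1" for n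
  proof -
    obtain k where k: "k < 2" "next_level k n = n + 1" by (rule ex_upward_letter)
    then have "k < 4" by simp
    have "f (n + 1) = level (g (step k (W n)))"
      using f[of "step k (W n)"] W \<open>k < 4\<close> k(2) by (simp add: level_step)
    also have "\<dots> = next_level (local_action g (W n) k) (f n)"
      using tree_aut_step(1)[OF level_group_aut[OF g] W(1) \<open>k < 4\<close>] by (simp add: level_step f_def)
    finally show ?thesis by (simp add: next_level_def)
  qed
  have f0: "f 0 = 0" using f[of "[]"] root by simp
  have f1: "f 1 = 1" using f[of "[0]"] assms(3) by (simp add: singleton_words next_level_def)
  have "f n = n \<and> f (n + 1) = n + 1" for n
  proof (induction n rule: int_induct[where k = 0])
    case (step1 n)
    then show ?case using near[of "n + 1"] inj[of "n + 1 + 1" n] by auto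
  next
    case (step2 n)
    then show ?case using near[of "n - 1"] inj[of "n - 1" "n + 1"] by auto
  qed (simp add: f0 f1)
  then show ?thesis using f[OF w] by simp
qed

text \<open>
  Since levels are preserved, the local action at a vertex can only exchange the two upward labels or the two
  downward labels. The upward part at level \<open>n\<close> is recorded by \<open>\<theta> n\<close>, and the downward part is the
  upward part seen from the other end of the edge.
\<close>

lemma rigid_is_switch:
  assumes g: "g \<in> level_group" and root: "g [] = []" and up: "level (g [0]) = 1"
  shows "g \<in> range switch_aut"
proof -
  note aut = level_group_aut[OF g]
  note lev = level_preserving[OF assms]
  \<comment> \<open>The letter \<open>u n\<close> leads up from level \<open>n\<close>; the other such letter is \<open>(u n + 2) mod 4\<close>.\<close>
  define u :: "int \<Rightarrow> nat" where "u n = (if even n then 0 else 1)" for n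
  have u: "u n < 4" for n by (simp add: u_def)
  define \<theta> where "\<theta> n \<longleftrightarrow> (\<exists>w \<in> words 4. level w = n \<and> local_action g w (u n) \<noteq> u n)" for n
  have \<theta>: "\<theta> (level w) \<longleftrightarrow> local_action g w (u (level w)) \<noteq> u (level w)" if "w \<in> words 4" for w
  proof -
    have "local_action g x (u (level w)) = local_action g w (u (level w))"
      if "x \<in> words 4" "level x = level w" for x
      using level_group_local_action[OF g that(1) \<open>w \<in> words 4\<close> that(2) u] .
    then show ?thesis unfolding \<theta>_def using that by metis
  qed
  have same_parity: "i = k \<or> i = (k + 2) mod 4" if "even i \<longleftrightarrow> even k" "i < 4" "k < 4" for i k :: nat
    using that by presburger
  have parity: "local_action g w k = k \<or> local_action g w k = (k + 2) mod 4"
    if w: "w \<in> words 4" and k: "k < 4" for w k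
  proof -
    let ?j = "local_action g w k"
    have "next_level ?j (level w) = level (g (step k w))"
      using tree_aut_step(1)[OF aut w k] lev[OF w] by (simp add: level_step)
    also have "\<dots> = next_level k (level w)"
      using lev w k by (simp add: level_step)
    finally have "even (level w + int ?j) \<longleftrightarrow> even (level w + int k)"
      by (simp add: next_level_def split: if_splits)
    then have "even ?j \<longleftrightarrow> even k" unfolding even_add even_of_nat by blast
    then show ?thesis by (rule same_parity[OF _ tree_aut_step(2)[OF aut w k] k])
  qed
  have inj: "j = k" if "local_action g w j = local_action g w k" "w \<in> words 4" "j < 4" "k < 4" for w j k
  proof -
    have "g (step j w) = g (step k w)"
      using that tree_aut_step(1)[OF aut] by metis
    then show ?thesis using that tree_aut_inject[OF aut, of "step j w" "step k w"] by simp
  qed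
  have upward: "local_action g w k = switch \<theta> (level w) k"
    if w: "w \<in> words 4" and k: "k < 4" and *: "next_level k (level w) = level w + 1" for w k
  proof -
    let ?u = "u (level w)"
    have "even (level w + int k)" using * by (simp add: next_level_def split: if_splits)
    then have "even k \<longleftrightarrow> even (level w)" by simp
    then have "even k \<longleftrightarrow> even ?u" by (simp add: u_def)
    then have cases: "k = ?u \<or> k = (?u + 2) mod 4" by (rule same_parity[OF _ k u])
    have flip: "((?u + 2) mod 4 + 2) mod 4 = ?u" "(?u + 2) mod 4 \<noteq> ?u" "(?u + 2) mod 4 < 4"
      by (auto simp: u_def)
    have "switch \<theta> (level w) k = (if \<theta> (level w) then (k + 2) mod 4 else k)"
      using * by (simp add: switch_def)
    then show ?thesis
      using cases flip \<theta>[OF w] parity[OF w u] parity[OF w flip(3)] inj[OF _ w u flip(3)] by metis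
  qed
  have switch: "local_action g w k = switch \<theta> (level w) k" if w: "w \<in> words 4" and k: "k < 4" for w k
  proof (cases "next_level k (level w) = level w + 1")
    case True
    then show ?thesis using upward w k by simp
  next
    case False
    then have "next_level k (level (step k w)) = level (step k w) + 1"
      by (simp add: level_step) (simp add: next_level_def split: if_splits)
    then have "local_action g (step k w) k = switch \<theta> (level (step k w)) k"
      using upward w k by simp
    then show ?thesis
      using local_action_back[OF aut w k] switch.edge[OF k] by (simp add: level_step)
  qed
  have "g w = relabel (switch \<theta>) w" if "w \<in> words 4" for w
    using that
  proof (induction rule: words_induct)
    case (step k w)
    then show ?case using tree_aut_step(1)[OF aut step(1,2)] switch switch.relabel_step by simp
  qed (simp add: root)
  then have "g = switch_aut \<theta>"
    using level_group_Bij[OF g] unfolding switch_aut_def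
    by (intro extensionalityI[of _ "words 4"]) (auto simp: Bij_def)
  then show ?thesis by blast
qed

text \<open>
  This description by the images of two vertices shows that the switches form an open subset of the
  level group.
\<close>

lemma range_switch_aut_eq: "range switch_aut = {g \<in> level_group. g [] = [] \<and> level (g [0]) = 1}"
proof -
  have "switch_aut \<theta> [] = []" "level (switch_aut \<theta> [0]) = 1" for \<theta>
    using switch.level_relabel[of "[0]" \<theta>]
    by (simp_all add: switch_aut_def singleton_words next_level_def)
  then show ?thesis using rigid_is_switch switch_aut_in_level_group by auto
qed

lemma infinite_range_switch_aut: "infinite (range switch_aut)"
proof
  assume fin: "finite (range switch_aut)"
  have "inj switch_aut"
  proof (rule injI, rule ext)
    fix \<theta> \<theta>' :: "int \<Rightarrow> bool" and n assume eq: "switch_aut \<theta> = switch_aut \<theta>'"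
    obtain w where w: "w \<in> words 4" "level w = n" using ex_word_level by blast
    obtain k where k: "k < 2" "next_level k n = n + 1" by (rule ex_upward_letter)
    have eq': "relabel (switch \<theta>) x = relabel (switch \<theta>') x" if "x \<in> words 4" for x
      using fun_cong[OF eq, of x] that by (simp add: switch_aut_def)
    have "step (switch \<theta> n k) (relabel (switch \<theta>) w) = step (switch \<theta>' n k) (relabel (switch \<theta>') w)"
      using eq'[of "step k w"] w k(1) by (simp add: switch.relabel_step)
    then have "switch \<theta> n k = switch \<theta>' n k" using eq'[OF w(1)] by simp
    then show "\<theta> n = \<theta>' n" using k by (simp add: switch_def split: if_splits)
  qed
  then have "finite (UNIV :: (int \<Rightarrow> bool) set)" using fin finite_imageD by blast
  then show False using finite_fun_UNIVD1[where 'a = int and 'b = bool] by simp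
qed

section \<open>Transitivity and generation\<close>

abbreviation LG :: "(nat list \<Rightarrow> nat list) monoid" where
  "LG \<equiv> aut_subgroup (word_tree 4) level_group"

lemma carrier_LG [simp]: "carrier LG = level_group"
  by (simp add: aut_subgroup_def)

lemma mult_LG [simp]:
  "g \<in> level_group \<Longrightarrow> h \<in> level_group \<Longrightarrow> g \<otimes>\<^bsub>LG\<^esub> h = compose (words 4) g h"
  by (simp add: aut_subgroup_def BijGroup_def level_group_Bij)

lemma group_LG: "group LG"
  using subgroup.subgroup_is_group[OF subgroup_level_group group_BijGroup] by (simp add: aut_subgroup_def)

lemma inv_LG:
  assumes g: "g \<in> level_group"
  shows "inv\<^bsub>LG\<^esub> g \<in> level_group" "w \<in> words 4 \<Longrightarrow> (inv\<^bsub>LG\<^esub> g) (g w) = w"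
proof -
  show inv: "inv\<^bsub>LG\<^esub> g \<in> level_group" using group.inv_closed[OF group_LG] g by simp
  have "compose (words 4) (inv\<^bsub>LG\<^esub> g) g = \<one>\<^bsub>LG\<^esub>"
    using group.l_inv[OF group_LG, of g] g inv by simp
  then show "w \<in> words 4 \<Longrightarrow> (inv\<^bsub>LG\<^esub> g) (g w) = w"
    by (auto simp: compose_def aut_subgroup_def BijGroup_def dest: fun_cong[of _ _ w])
qed

definition reflection_aut :: "nat list \<Rightarrow> nat list" where
  "reflection_aut = restrict (relabel (\<lambda>n k. 3 - k)) (words 4)"

definition shift_aut :: "nat \<Rightarrow> nat list \<Rightarrow> nat list" where
  "shift_aut j = restrict (shift j) (words 4)"

lemma reflection_aut_in_level_group: "reflection_aut \<in> level_group"
  unfolding reflection_aut_def by (rule reflection.relabel_in_level_group)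

definition generators :: "(nat list \<Rightarrow> nat list) set" where
  "generators = range switch_aut \<union> insert reflection_aut (shift_aut ` {..<4})"

lemma generators_level_group: "generators \<subseteq> level_group"
  by (auto simp: generators_def switch_aut_in_level_group reflection_aut_in_level_group
      shift_aut_def shift_in_level_group)

lemma generate_level_group: "g \<in> generate LG generators \<Longrightarrow> g \<in> level_group"
  using group.generate_in_carrier[OF group_LG, of generators g] generators_level_group by simp

text \<open>
  A product of shifts is a left translation of the free product, and these are transitive on vertices
  and preserve all labels.
\<close>

lemma ex_translation:
  assumes "v \<in> words 4"
  shows "\<exists>g \<in> generate LG generators. g [] = v \<and>
    (\<forall>w \<in> words 4. \<forall>k<4. g (step k w) = step k (g w))"
  using assms
proof (induction rule: words_induct)
  case Nil
  have "switch_aut (\<lambda>_. False) \<in> generate LG generators"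
    by (rule generate.incl) (simp add: generators_def)
  moreover have "switch (\<lambda>_. False) n k = k" for n k by (simp add: switch_def)
  ultimately show ?case
    by (intro bexI[of _ "switch_aut (\<lambda>_. False)"]) (auto simp: switch_aut_def switch.relabel_step)
next
  case (step j v)
  then obtain g where g: "g \<in> generate LG generators" "g [] = v"
    "\<And>w k. w \<in> words 4 \<Longrightarrow> k < 4 \<Longrightarrow> g (step k w) = step k (g w)" by blast
  have s: "shift_aut j \<in> generate LG generators"
    by (rule generate.incl) (use step in \<open>simp add: generators_def\<close>)
  have "g \<otimes>\<^bsub>LG\<^esub> shift_aut j \<in> generate LG generators" using g(1) s by (rule generate.eng)
  then have "compose (words 4) g (shift_aut j) \<in> generate LG generators"
    using generate_level_group[OF g(1)] generate_level_group[OF s] by simp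
  moreover have "compose (words 4) g (shift_aut j) [] = step j v"
    using g(2) g(3)[of "[]" j] step(2) by (simp add: compose_eq shift_aut_def)
  moreover have "compose (words 4) g (shift_aut j) (step k w) = step k (compose (words 4) g (shift_aut j) w)"
    if "w \<in> words 4" "k < 4" for w k
    using that g(3)[of "shift j w" k] step(2) by (simp add: compose_eq shift_aut_def shift_step shift_words)
  ultimately show ?case by blast
qed

text \<open>
  After a translation \<open>h\<close> fixes the root, and then possibly after the reflection it also fixes the
  direction of the line, which makes it a switch.
\<close>

lemma generate_generators: "generate LG generators = level_group"
proof
  show "generate LG generators \<subseteq> level_group" using generate_level_group by blast
  show "level_group \<subseteq> generate LG generators"
  proof
    interpret group LG by (rule group_LG)
    have cancel: "inv\<^bsub>LG\<^esub> x \<otimes>\<^bsub>LG\<^esub> (x \<otimes>\<^bsub>LG\<^esub> y) = y" "x \<otimes>\<^bsub>LG\<^esub> (inv\<^bsub>LG\<^esub> x \<otimes>\<^bsub>LG\<^esub> y) = y"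
      if "x \<in> carrier LG" "y \<in> carrier LG" for x y
      using that by (simp_all add: m_assoc[symmetric] del: carrier_LG mult_LG)
    fix h assume h: "h \<in> level_group"
    then have "h [] \<in> words 4" using level_group_words by simp
    then obtain g where g: "g \<in> generate LG generators" "g [] = h []" using ex_translation by blast
    note gL = generate_level_group[OF g(1)]
    define h' where "h' = inv\<^bsub>LG\<^esub> g \<otimes>\<^bsub>LG\<^esub> h"
    have h': "h' \<in> level_group" "h' [] = []"
      using inv_LG[OF gL] h g(2)[symmetric] by (simp_all add: h'_def compose_level_group compose_eq)
    have "h' (step 0 []) = step (local_action h' [] 0) (h' [])"
      by (rule tree_aut_step(1)[OF level_group_aut[OF h'(1)]]) simp_all
    then have "level (h' [0]) = 1 \<or> level (h' [0]) = - 1"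
      using h'(2) by (auto simp: next_level_def)
    then have "h' \<in> generate LG generators"
    proof
      assume "level (h' [0]) = 1"
      then have "h' \<in> generators" using h' range_switch_aut_eq by (auto simp: generators_def)
      then show ?thesis by (rule generate.incl)
    next
      assume *: "level (h' [0]) = - 1"
      define k where "k = compose (words 4) reflection_aut h'"
      have kL: "k \<in> level_group"
        unfolding k_def by (rule compose_level_group[OF reflection_aut_in_level_group h'(1)])
      have "h' [0] \<in> words 4" using level_group_words[OF h'(1)] by (simp add: singleton_words)
      then have "k [] = []" "level (k [0]) = 1"
        using h'(2) * reflection.level_relabel
        by (simp_all add: k_def compose_eq reflection_aut_def singleton_words)
      then have "k \<in> generators" using kL range_switch_aut_eq by (auto simp: generators_def)
      then have "inv\<^bsub>LG\<^esub> reflection_aut \<otimes>\<^bsub>LG\<^esub> k \<in> generate LG generators"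
        by (intro generate.eng generate.inv generate.incl) (simp_all add: generators_def)
      moreover have "inv\<^bsub>LG\<^esub> reflection_aut \<otimes>\<^bsub>LG\<^esub> k = h'"
        using cancel(1)[of reflection_aut h'] h'(1) reflection_aut_in_level_group
        by (simp add: k_def)
      ultimately show ?thesis by (simp only:)
    qed
    then have "g \<otimes>\<^bsub>LG\<^esub> h' \<in> generate LG generators" using g(1) by (intro generate.eng)
    moreover have "g \<otimes>\<^bsub>LG\<^esub> h' = h"
      unfolding h'_def using gL h by (intro cancel(2)) simp_all
    ultimately show "h \<in> generate LG generators" by simp
  qed
qed

text \<open>
  Switching every edge of the line sends \<open>k\<close> to the other letter of its parity, and the reflection
  changes the parity.
\<close>

lemma root_stabilizer_transitive:
  assumes "k < 4" "j < 4"
  shows "\<exists>h \<in> level_group. h [] = [] \<and> h [k] = [j]"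
proof -
  let ?flip = "switch_aut (\<lambda>_. True)"
  have mirror: "3 - k < 4" by linarith
  have at_k: "switch_aut (\<lambda>_. False) [k] = [k]" "?flip [k] = [(k + 2) mod 4]" "reflection_aut [k] = [3 - k]"
    "compose (words 4) ?flip reflection_aut [k] = [(3 - k + 2) mod 4]"
    using assms(1) mirror by (simp_all add: switch_aut_def switch_def reflection_aut_def compose_eq singleton_words)
  have at_root: "switch_aut (\<lambda>_. False) [] = []" "?flip [] = []" "reflection_aut [] = []"
    "compose (words 4) ?flip reflection_aut [] = []"
    by (simp_all add: switch_aut_def reflection_aut_def compose_eq)
  have in_group: "compose (words 4) ?flip reflection_aut \<in> level_group"
    by (intro compose_level_group switch_aut_in_level_group reflection_aut_in_level_group)
  have "k = 0 \<or> k = 1 \<or> k = 2 \<or> k = 3" "j = 0 \<or> j = 1 \<or> j = 2 \<or> j = 3"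
    using assms by linarith+
  then consider "j = k" | "j = (k + 2) mod 4" | "j = 3 - k" | "j = (3 - k + 2) mod 4"
    by (elim disjE) simp_all
  then show ?thesis
  proof cases
    case 1
    then show ?thesis using at_k(1) at_root(1) switch_aut_in_level_group by blast
  next
    case 2
    then show ?thesis using at_k(2) at_root(2) switch_aut_in_level_group by blast
  next
    case 3
    then show ?thesis using at_k(3) at_root(3) reflection_aut_in_level_group by blast
  next
    case 4
    then show ?thesis using at_k(4) at_root(4) in_group by blast
  qed
qed

text \<open>
  Conjugate the stabilizer of the root by a label-preserving translation.
\<close>

lemma locally_transitive_level_group: "locally_transitive (word_tree 4) level_group"
  unfolding locally_transitive_def
proof (intro ballI)
  fix x e e' assume x: "x \<in> pverts (word_tree 4)"
    and "e \<in> out_arcs (with_proj (word_tree 4)) x" "e' \<in> out_arcs (with_proj (word_tree 4)) x"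
  then obtain k j where e: "e = (x, step k x)" "k < 4" and e': "e' = (x, step j x)" "j < 4"
    by (auto simp: out_arcs_word_tree simp del: in_out_arcs_conv)
  obtain g where "g \<in> generate LG generators" and g: "g [] = x"
    "\<And>w k. w \<in> words 4 \<Longrightarrow> k < 4 \<Longrightarrow> g (step k w) = step k (g w)"
    using ex_translation[of x] x by auto
  then have gL: "g \<in> level_group" by (simp add: generate_level_group)
  obtain h where h: "h \<in> level_group" "h [] = []" "h [k] = [j]"
    using root_stabilizer_transitive[OF e(2) e'(2)] by blast
  define h' where "h' = compose (words 4) (compose (words 4) g h) (inv\<^bsub>LG\<^esub> g)"
  have h'L: "h' \<in> level_group"
    unfolding h'_def by (intro compose_level_group gL h(1) inv_LG(1))
  have conj: "h' (g w) = g (h w)" if "w \<in> words 4" for w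
    using that level_group_words[OF gL that] inv_LG(2)[OF gL that] by (simp add: h'_def compose_eq)
  have "h' x = x" using conj[of "[]"] g(1) h(2) by simp
  moreover have "h' (step k x) = step j x"
    using conj[of "[k]"] g(1) g(2)[of "[]" k] g(2)[of "[]" j] h(3) e(2) e'(2) by (simp add: singleton_words)
  ultimately show "\<exists>h \<in> stabilizer LG (\<lambda>g. g) x. map_prod h h e = e'"
    using h'L e(1) e'(1) by (intro bexI[of _ h']) (auto simp: stabilizer_def)
qed

section \<open>Topological properties of the level group\<close>

lemma closedin_level_group: "closedin (perm_topology (word_tree 4)) level_group"
proof -
  let ?P = "perm_topology (word_tree 4)"
  let ?B = "\<lambda>x y. {g \<in> tree_aut (word_tree 4). \<not> level_compatible g x y}"
  have "openin ?P (?B x y)" if xy: "x \<in> words 4" "y \<in> words 4" for x y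
  proof (rule openin_perm_topology_finite_dependence)
    let ?F = "{x, y} \<union> (\<lambda>k. step k x) ` {..<4} \<union> (\<lambda>k. step k y) ` {..<4}"
    show "finite ?F" by simp
    show "?F \<subseteq> pverts (word_tree 4)" using xy by auto
    fix g h assume "\<And>z. z \<in> ?F \<Longrightarrow> g z = h z" and *: "\<not> level_compatible g x y"
    then have "g x = h x" "g y = h y" "\<And>k. k < 4 \<Longrightarrow> g (step k x) = h (step k x)"
      "\<And>k. k < 4 \<Longrightarrow> g (step k y) = h (step k y)" by auto
    then have "level_compatible g x y = level_compatible h x y"
      by (auto simp: level_compatible_def local_action_def)
    with * show "\<not> level_compatible h x y" by simp
  qed
  then have "openin ?P (\<Union>x\<in>words 4. \<Union>y\<in>words 4. ?B x y)" by auto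
  moreover have "topspace ?P - level_group = (\<Union>x\<in>words 4. \<Union>y\<in>words 4. ?B x y)"
    by (auto simp: topspace_perm_topology level_group_def)
  ultimately show ?thesis
    by (auto simp: closedin_def topspace_perm_topology level_group_aut)
qed

text \<open>
  The subsets \<open>\<theta>\<close> of \<open>\<int>\<close> form a compact space by Tychonoff's theorem, and the image of a word under
  \<open>switch_aut \<theta>\<close> depends on \<open>\<theta>\<close> only at the finitely many edges of the line that the word crosses.
\<close>

lemma compactin_range_switch_aut: "compactin (perm_topology (word_tree 4)) (range switch_aut)"
proof -
  define C where "C = product_topology (\<lambda>_ :: int. discrete_topology (UNIV :: bool set)) UNIV"
  have topC: "topspace C = UNIV" by (simp add: C_def)
  have compact: "compact_space C"
    by (simp add: C_def compact_space_product_topology compact_space_discrete_topology)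
  have coord: "openin C {\<theta>. Q (\<theta> m)}" for Q m
  proof -
    have "continuous_map C (discrete_topology UNIV) (\<lambda>\<theta>. \<theta> m)"
      unfolding C_def by (rule continuous_map_product_projection) simp
    from openin_continuous_map_preimage[OF this, of "{b. Q b}"] show ?thesis by (simp add: topC)
  qed
  have "openin C {\<theta>. relabel (switch \<theta>) w = v}" for w v
  proof (induction w arbitrary: v)
    case Nil
    show ?case using openin_topspace[of C] by (cases "v = []") (simp_all add: topC)
  next
    case (Cons k w)
    show ?case
    proof (cases v)
      case (Cons j u)
      let ?m = "min (level w) (next_level k (level w))"
      have eq: "{\<theta>. relabel (switch \<theta>) (k # w) = v} =
          {\<theta>. (if \<theta> ?m then (k + 2) mod 4 else k) = j} \<inter> {\<theta>. relabel (switch \<theta>) w = u}"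
        by (auto simp: Cons switch_def)
      show ?thesis
        unfolding eq by (rule openin_Int[OF coord[of "\<lambda>b. (if b then (k + 2) mod 4 else k) = j"] Cons.IH])
    qed simp
  qed
  then have "continuous_map C (perm_topology (word_tree 4)) switch_aut"
    using level_group_aut[OF switch_aut_in_level_group]
    by (intro continuous_map_into_perm_topology pair_wf_word_tree) (auto simp: switch_aut_def topC)
  then show ?thesis
    using image_compactin[of C UNIV] compact by (simp add: compact_space_def topC)
qed

section \<open>A group with open quasi-center\<close>

theorem theorem4p4:
  shows "\<exists>d \<ge> 3. \<exists>T :: nat list pair_pre_digraph. regular_tree d T \<and>
    (\<exists>H. subgroup H (aut_group T) \<and>
         closedin (perm_topology T) H \<and>
         \<not> discrete_in (perm_topology T) H \<and>
         compactly_generated (aut_subgroup T H) (subtopology (perm_topology T) H) \<and>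
         locally_transitive T H \<and>
         openin (subtopology (perm_topology T) H)
           (quasi_center (aut_subgroup T H) (subtopology (perm_topology T) H)) \<and>
         \<not> discrete_in (perm_topology T)
           (quasi_center (aut_subgroup T H) (subtopology (perm_topology T) H)))"
proof -
  let ?T = "word_tree 4"
  let ?P = "perm_topology ?T"
  let ?\<tau> = "subtopology ?P level_group"
  let ?A = "range switch_aut"
  have A: "?A \<subseteq> level_group" using switch_aut_in_level_group by blast
  interpret left_topological_group LG ?\<tau>
    by (rule left_topological_aut_subgroup[OF pair_wf_word_tree])
      (use subgroup_level_group level_group_aut in auto)
  have sub: "subgroup level_group (aut_group ?T)"
    unfolding aut_subgroup_def
    using subgroup_level_group subgroup_tree_aut[of ?T] level_group_aut
    by (intro group.subgroup_incl[OF group_BijGroup]) auto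
  have "openin ?P {g \<in> tree_aut ?T. g [] = [] \<and> level (g [0]) = 1}"
    by (rule openin_perm_topology_finite_dependence[of "{[], [0]}"]) (auto simp: singleton_words)
  moreover have "?A = {g \<in> tree_aut ?T. g [] = [] \<and> level (g [0]) = 1} \<inter> level_group"
    using range_switch_aut_eq level_group_aut by blast
  ultimately have A_open: "openin ?\<tau> ?A" unfolding openin_subtopology by blast
  have A_comm: "a \<otimes>\<^bsub>LG\<^esub> b = b \<otimes>\<^bsub>LG\<^esub> a" if "a \<in> ?A" "b \<in> ?A" for a b
    using that switch_aut_commute switch_aut_in_level_group by auto
  have A_ne: "?A \<noteq> {}" by simp
  note QZ = open_abelian_subgroup_in_quasi_center[OF A_open A_ne A_comm]
  have not_discrete: "\<not> discrete_in ?P S" if "?A \<subseteq> S" for S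
    using discrete_in_compact_finite[OF _ compactin_range_switch_aut that] infinite_range_switch_aut by blast
  have "compactin ?P (insert reflection_aut (shift_aut ` {..<4}))"
    using generators_level_group level_group_aut
    by (intro finite_imp_compactin) (auto simp: generators_def topspace_perm_topology)
  then have "compactin ?P generators"
    unfolding generators_def by (intro compactin_Un compactin_range_switch_aut)
  then have "compactly_generated LG ?\<tau>"
    using generators_level_group generate_generators
    by (auto simp: compactly_generated_def compactin_subtopology)
  then show ?thesis
    using regular_tree_word_tree[of 4] sub closedin_level_group not_discrete[OF A] not_discrete[OF QZ(1)]
      QZ(2) locally_transitive_level_group
    by (intro exI[of _ 4] conjI exI[of _ ?T] exI[of _ level_group]) simp_all
qed

end
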